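(* The systems $\mathsf{NS}_{\mathsf{mLJ}}$, $\mathsf{LNS}_{\mathsf{mLJ}}$, $\mathsf{mLJ}$ and $\mathsf{LbNS}_{\mathsf{mLJ}}$ are equivalent: for all finite multisets of formulae $\Gamma,\Delta$, the sequent $\Gamma\vdash\Delta$ is derivable in $\mathsf{mLJ}$ iff it is derivable (as a nested sequent) in $\mathsf{NS}_{\mathsf{mLJ}}$ iff it is derivable (as a linear nested sequent) in $\mathsf{LNS}_{\mathsf{mLJ}}$ iff $x\!:\!\Gamma\vdash x\!:\!\Delta$ is derivable in $\mathsf{LbNS}_{\mathsf{mLJ}}$.
   Context: Formulae are built from atoms, $\bot,\land,\lor,\supset$; $P$ denotes an atom. (1) $\mathsf{mLJ}$ is Maehara's multi-conclusion sequent calculus: axioms $\Gamma,\bot\vdash\Delta$ and $\Gamma,P\vdash P,\Delta$; rules $\land_L,\land_R,\lor_L,\lor_R$ as in classical context-sharing sequent calculus (e.g. $\Gamma,A\land B\vdash\Delta$ from $\Gamma,A,B\vdash\Delta$; $\Gamma\vdash A\land B,\Delta$ from $\Gamma\vdash A,\Delta$ and $\Gamma\vdash B,\Delta$; $\Gamma,A\lor B\vdash\Delta$ from $\Gamma,A\vdash\Delta$ and $\Gamma,B\vdash\Delta$; $\Gamma\vdash A\lor B,\Delta$ from $\Gamma\vdash A,B,\Delta$); $\supset_L$: $\Gamma,A\supset B\vdash\Delta$ from $\Gamma,A\supset B\vdash A,\Delta$ and $\Gamma,B\vdash\Delta$; $\supset_R$: $\Gamma\vdash A\supset B,\Delta$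 from $\Gamma,A\vdash B$. (2) Nested sequents: a sequent is one; if $G_i$ are nested sequents, $\Gamma\vdash\Delta,[G_1],\ldots,[G_n]$ is one; $\Lambda$ denotes multisets of nestings; $\Upsilon\{\;\}$ is a context with a hole, $\Upsilon\{\Upsilon'\}$ fills it with $[\Upsilon']$ (or equals $\Upsilon'$ if $\Upsilon$ is empty). $\mathsf{NS}_{\mathsf{mLJ}}$ consists of the $\mathsf{mLJ}$ rules for $\land,\lor$, $\bot$, $\mathsf{init}$ and $\supset_L$ applied inside a context, i.e. with each sequent $\Gamma\vdash\Delta$ replaced by $\Upsilon\{\Gamma\vdash\Delta,\Lambda\}$, together with $\supset_R$: $\Upsilon\{\Gamma\vdash\Delta,A\supset B,\Lambda\}$ from $\Upsilon\{\Gamma\vdash\Delta,\Lambda,[A\vdash B]\}$, and $\mathtt{lift}$: $\Upsilon\{\Gamma,A\vdash\Delta,\Lambda,[\Gamma'\vdash\Delta',\Lambda']\}$ from $\Upsilon\{\Gamma,A\vdash\Delta,\Lambda,[\Gamma',A\vdash\Delta',\Lambda']\}$. (3) Linear nested sequents are finite lists of sequents $\Gamma_1\vdash\Delta_1 /\!\!/ \cdots /\!\!/ \Gamma_n\vdash\Delta_n$; $\mathcal{G}$ denotes a (possibly empty) initial segment. $\mathsf{LNS}_{\mathsf{mLJ}}$ has the $\mathsf{mLJ}$ rules for $\land,\lor,\bot,\mathsf{init}$, $\supset_L$ applied to the last component (each sequent $\Gamma\vdash\Delta$ replaced by $\mathcal{G}/\!\!/\Gamma\vdash\Delta$, including both premises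 of two-premise rules; the axiom $\mathsf{init}$ is $\mathcal{G}/\!\!/\Gamma,A\vdash A,\Delta$), plus $\supset_R$: $\mathcal{G}/\!\!/\Gamma\vdash A\supset B,\Delta$ from $\mathcal{G}/\!\!/\Gamma\vdash\Delta/\!\!/A\vdash B$, and $\mathtt{lift}$: $\mathcal{G}/\!\!/\Gamma,A\vdash\Delta/\!\!/\Gamma'\vdash\Delta'$ from $\mathcal{G}/\!\!/\Gamma\vdash\Delta/\!\!/A,\Gamma'\vdash\Delta'$. (4) Labelled nested sequents: $\mathcal{R},X\vdash Y$ where $\mathcal{R}$ is a treelike set of relation terms $xRy$ on state variables, and $X,Y$ are multisets of labelled formulae $x\!:\!A$ (if $\mathcal{R}$ is empty all labels are the same variable; otherwise every label occurs in $\mathcal{R}$); $x\!:\!\Gamma$ denotes $\{x\!:\!A : A\in\Gamma\}$. $\mathsf{LbNS}_{\mathsf{mLJ}}$ is the image of $\mathsf{NS}_{\mathsf{mLJ}}$ under the translation sending each component of a nested sequent to a state variable and each nesting edge to a relation term $xRy$: the propositional rules and axioms act on formulae with a common label $x$ (e.g. $\mathcal{R},X,x\!:\!A\land B\vdash Y$ from $\mathcal{R},X,x\!:\!A,x\!:\!B\vdash Y$; axioms $\mathcal{R},X,x\!:\!P\vdash x\!:\!P,Y$ and $\mathcal{R},X,x\!:\!\bot\vdash Y$), $\supset_R$: $\mathcal{R},X\vdash Y,x\!:\!A\supset B$ from $\mathcal{R},xRy,X,y\!:\!A\vdash Y,y\!:\!B$ with $y$ fresh, and $\mathtt{lift}$: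 $\mathcal{R},xRy,X,x\!:\!A\vdash Y$ from $\mathcal{R},xRy,X,x\!:\!A,y\!:\!A\vdash Y$. *)

theory Defs
  imports "HOL-Library.Multiset"
begin

datatype 'a form =
    Atom 'a
  | Bot ("\<^bold>\<bottom>")
  | Conj "'a form" "'a form" (infixr "\<^bold>\<and>" 75)
  | Disj "'a form" "'a form" (infixr "\<^bold>\<or>" 74)
  | Imp "'a form" "'a form" (infixr "\<^bold>\<supset>" 73)


inductive mLJ :: "'a form multiset \<Rightarrow> 'a form multiset \<Rightarrow> bool" where
  mLJ_bot: "mLJ (add_mset \<^bold>\<bottom> \<Gamma>) \<Delta>"
| mLJ_init: "mLJ (add_mset (Atom P) \<Gamma>) (add_mset (Atom P) \<Delta>)"
| mLJ_conjL: "mLJ (add_mset A (add_mset B \<Gamma>)) \<Delta> \<Longrightarrow> mLJ (add_mset (A \<^bold>\<and> B) \<Gamma>) \<Delta>"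
| mLJ_conjR: "mLJ \<Gamma> (add_mset A \<Delta>) \<Longrightarrow> mLJ \<Gamma> (add_mset B \<Delta>) \<Longrightarrow>
    mLJ \<Gamma> (add_mset (A \<^bold>\<and> B) \<Delta>)"
| mLJ_disjL: "mLJ (add_mset A \<Gamma>) \<Delta> \<Longrightarrow> mLJ (add_mset B \<Gamma>) \<Delta> \<Longrightarrow>
    mLJ (add_mset (A \<^bold>\<or> B) \<Gamma>) \<Delta>"
| mLJ_disjR: "mLJ \<Gamma> (add_mset A (add_mset B \<Delta>)) \<Longrightarrow> mLJ \<Gamma> (add_mset (A \<^bold>\<or> B) \<Delta>)"
| mLJ_impL: "mLJ (add_mset (A \<^bold>\<supset> B) \<Gamma>) (add_mset A \<Delta>) \<Longrightarrow> mLJ (add_mset B \<Gamma>) \<Delta> \<Longrightarrow>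
    mLJ (add_mset (A \<^bold>\<supset> B) \<Gamma>) \<Delta>"
| mLJ_impR: "mLJ (add_mset A \<Gamma>) {#B#} \<Longrightarrow> mLJ \<Gamma> (add_mset (A \<^bold>\<supset> B) \<Delta>)"


datatype 'a nseq = NSeq "'a form multiset" "'a form multiset" "'a nseq multiset"

text \<open>The context \<open>CNest \<Gamma> \<Delta> \<Lambda> C\<close> is \<open>\<Gamma> \<turnstile> \<Delta>, \<Lambda>, [C]\<close>, so the hole always occupies the place of
  a whole component (together with its nestings).\<close>

datatype 'a nctx =
    CHole
  | CNest "'a form multiset" "'a form multiset" "'a nseq multiset" "'a nctx"

primrec fill :: "'a nctx \<Rightarrow> 'a nseq \<Rightarrow> 'a nseq" where
  "fill CHole G = G"
| "fill (CNest \<Gamma> \<Delta> \<Lambda> C) G = NSeq \<Gamma> \<Delta> (add_mset (fill C G) \<Lambda>)"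

inductive NS_mLJ :: "'a nseq \<Rightarrow> bool" where
  NS_bot: "NS_mLJ (fill C (NSeq (add_mset \<^bold>\<bottom> \<Gamma>) \<Delta> \<Lambda>))"
| NS_init: "NS_mLJ (fill C (NSeq (add_mset (Atom P) \<Gamma>) (add_mset (Atom P) \<Delta>) \<Lambda>))"
| NS_conjL: "NS_mLJ (fill C (NSeq (add_mset A (add_mset B \<Gamma>)) \<Delta> \<Lambda>)) \<Longrightarrow>
    NS_mLJ (fill C (NSeq (add_mset (A \<^bold>\<and> B) \<Gamma>) \<Delta> \<Lambda>))"
| NS_conjR: "NS_mLJ (fill C (NSeq \<Gamma> (add_mset A \<Delta>) \<Lambda>)) \<Longrightarrow>
    NS_mLJ (fill C (NSeq \<Gamma> (add_mset B \<Delta>) \<Lambda>)) \<Longrightarrow>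
    NS_mLJ (fill C (NSeq \<Gamma> (add_mset (A \<^bold>\<and> B) \<Delta>) \<Lambda>))"
| NS_disjL: "NS_mLJ (fill C (NSeq (add_mset A \<Gamma>) \<Delta> \<Lambda>)) \<Longrightarrow>
    NS_mLJ (fill C (NSeq (add_mset B \<Gamma>) \<Delta> \<Lambda>)) \<Longrightarrow>
    NS_mLJ (fill C (NSeq (add_mset (A \<^bold>\<or> B) \<Gamma>) \<Delta> \<Lambda>))"
| NS_disjR: "NS_mLJ (fill C (NSeq \<Gamma> (add_mset A (add_mset B \<Delta>)) \<Lambda>)) \<Longrightarrow>
    NS_mLJ (fill C (NSeq \<Gamma> (add_mset (A \<^bold>\<or> B) \<Delta>) \<Lambda>))"
| NS_impL: "NS_mLJ (fill C (NSeq (add_mset (A \<^bold>\<supset> B) \<Gamma>) (add_mset A \<Delta>) \<Lambda>)) \<Longrightarrow>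
    NS_mLJ (fill C (NSeq (add_mset B \<Gamma>) \<Delta> \<Lambda>)) \<Longrightarrow>
    NS_mLJ (fill C (NSeq (add_mset (A \<^bold>\<supset> B) \<Gamma>) \<Delta> \<Lambda>))"
| NS_impR: "NS_mLJ (fill C (NSeq \<Gamma> \<Delta> (add_mset (NSeq {#A#} {#B#} {#}) \<Lambda>))) \<Longrightarrow>
    NS_mLJ (fill C (NSeq \<Gamma> (add_mset (A \<^bold>\<supset> B) \<Delta>) \<Lambda>))"
| NS_lift: "NS_mLJ (fill C (NSeq (add_mset A \<Gamma>) \<Delta> (add_mset (NSeq (add_mset A \<Gamma>') \<Delta>' \<Lambda>') \<Lambda>))) \<Longrightarrow>
    NS_mLJ (fill C (NSeq (add_mset A \<Gamma>) \<Delta> (add_mset (NSeq \<Gamma>' \<Delta>' \<Lambda>') \<Lambda>)))"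


text \<open>Unlike in the other calculi, \<open>init\<close> is not restricted to atoms here, and \<open>lift\<close> moves
  the formula instead of copying it.\<close>

inductive LNS_mLJ :: "('a form multiset \<times> 'a form multiset) list \<Rightarrow> bool" where
  LNS_bot: "LNS_mLJ (G @ [(add_mset \<^bold>\<bottom> \<Gamma>, \<Delta>)])"
| LNS_init: "LNS_mLJ (G @ [(add_mset A \<Gamma>, add_mset A \<Delta>)])"
| LNS_conjL: "LNS_mLJ (G @ [(add_mset A (add_mset B \<Gamma>), \<Delta>)]) \<Longrightarrow>
    LNS_mLJ (G @ [(add_mset (A \<^bold>\<and> B) \<Gamma>, \<Delta>)])"
| LNS_conjR: "LNS_mLJ (G @ [(\<Gamma>, add_mset A \<Delta>)]) \<Longrightarrow> LNS_mLJ (G @ [(\<Gamma>, add_mset B \<Delta>)]) \<Longrightarrow>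
    LNS_mLJ (G @ [(\<Gamma>, add_mset (A \<^bold>\<and> B) \<Delta>)])"
| LNS_disjL: "LNS_mLJ (G @ [(add_mset A \<Gamma>, \<Delta>)]) \<Longrightarrow> LNS_mLJ (G @ [(add_mset B \<Gamma>, \<Delta>)]) \<Longrightarrow>
    LNS_mLJ (G @ [(add_mset (A \<^bold>\<or> B) \<Gamma>, \<Delta>)])"
| LNS_disjR: "LNS_mLJ (G @ [(\<Gamma>, add_mset A (add_mset B \<Delta>))]) \<Longrightarrow>
    LNS_mLJ (G @ [(\<Gamma>, add_mset (A \<^bold>\<or> B) \<Delta>)])"
| LNS_impL: "LNS_mLJ (G @ [(add_mset (A \<^bold>\<supset> B) \<Gamma>, add_mset A \<Delta>)]) \<Longrightarrow>
    LNS_mLJ (G @ [(add_mset B \<Gamma>, \<Delta>)]) \<Longrightarrow>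
    LNS_mLJ (G @ [(add_mset (A \<^bold>\<supset> B) \<Gamma>, \<Delta>)])"
| LNS_impR: "LNS_mLJ (G @ [(\<Gamma>, \<Delta>), ({#A#}, {#B#})]) \<Longrightarrow>
    LNS_mLJ (G @ [(\<Gamma>, add_mset (A \<^bold>\<supset> B) \<Delta>)])"
| LNS_lift: "LNS_mLJ (G @ [(\<Gamma>, \<Delta>), (add_mset A \<Gamma>', \<Delta>')]) \<Longrightarrow>
    LNS_mLJ (G @ [(add_mset A \<Gamma>, \<Delta>), (\<Gamma>', \<Delta>')])"


text \<open>State variables are natural numbers, so that fresh ones are always available.\<close>

type_synonym label = nat
type_synonym 'a lform = "label \<times> 'a form"

definition lab :: "label \<Rightarrow> 'a form multiset \<Rightarrow> 'a lform multiset" where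
  "lab x \<Gamma> = image_mset (Pair x) \<Gamma>"

definition labels :: "'a lform multiset \<Rightarrow> label set" where
  "labels X = fst ` set_mset X"

text \<open>Empty, or the edge set of a finite rooted tree with edges directed away from the root:
  the root has no predecessor and reaches every node, and no node has two predecessors.\<close>

definition treelike :: "label rel \<Rightarrow> bool" where
  "treelike R \<longleftrightarrow> R = {} \<or>
     (finite R \<and> single_valued (R\<inverse>) \<and> (\<exists>r. r \<notin> Range R \<and> (\<forall>x\<in>Field R. (r, x) \<in> R\<^sup>*)))"

definition labelled_nseq :: "label rel \<Rightarrow> 'a lform multiset \<Rightarrow> 'a lform multiset \<Rightarrow> bool" where
  "labelled_nseq R X Y \<longleftrightarrow> treelike R \<and>
     (if R = {} then \<exists>x. labels X \<union> labels Y \<subseteq> {x} else labels X \<union> labels Y \<subseteq> Field R)"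

text \<open>The premise \<open>labelled_nseq\<close> in each rule says that the conclusion is a labelled nested
  sequent; hence only labelled nested sequents occur in derivations.\<close>

inductive LbNS_mLJ :: "label rel \<Rightarrow> 'a lform multiset \<Rightarrow> 'a lform multiset \<Rightarrow> bool" where
  LbNS_bot: "labelled_nseq R (add_mset (x, \<^bold>\<bottom>) X) Y \<Longrightarrow> LbNS_mLJ R (add_mset (x, \<^bold>\<bottom>) X) Y"
| LbNS_init: "labelled_nseq R (add_mset (x, Atom P) X) (add_mset (x, Atom P) Y) \<Longrightarrow>
    LbNS_mLJ R (add_mset (x, Atom P) X) (add_mset (x, Atom P) Y)"
| LbNS_conjL: "labelled_nseq R (add_mset (x, A \<^bold>\<and> B) X) Y \<Longrightarrow>
    LbNS_mLJ R (add_mset (x, A) (add_mset (x, B) X)) Y \<Longrightarrow>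
    LbNS_mLJ R (add_mset (x, A \<^bold>\<and> B) X) Y"
| LbNS_conjR: "labelled_nseq R X (add_mset (x, A \<^bold>\<and> B) Y) \<Longrightarrow>
    LbNS_mLJ R X (add_mset (x, A) Y) \<Longrightarrow> LbNS_mLJ R X (add_mset (x, B) Y) \<Longrightarrow>
    LbNS_mLJ R X (add_mset (x, A \<^bold>\<and> B) Y)"
| LbNS_disjL: "labelled_nseq R (add_mset (x, A \<^bold>\<or> B) X) Y \<Longrightarrow>
    LbNS_mLJ R (add_mset (x, A) X) Y \<Longrightarrow> LbNS_mLJ R (add_mset (x, B) X) Y \<Longrightarrow>
    LbNS_mLJ R (add_mset (x, A \<^bold>\<or> B) X) Y"
| LbNS_disjR: "labelled_nseq R X (add_mset (x, A \<^bold>\<or> B) Y) \<Longrightarrow>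
    LbNS_mLJ R X (add_mset (x, A) (add_mset (x, B) Y)) \<Longrightarrow>
    LbNS_mLJ R X (add_mset (x, A \<^bold>\<or> B) Y)"
| LbNS_impL: "labelled_nseq R (add_mset (x, A \<^bold>\<supset> B) X) Y \<Longrightarrow>
    LbNS_mLJ R (add_mset (x, A \<^bold>\<supset> B) X) (add_mset (x, A) Y) \<Longrightarrow>
    LbNS_mLJ R (add_mset (x, B) X) Y \<Longrightarrow>
    LbNS_mLJ R (add_mset (x, A \<^bold>\<supset> B) X) Y"
| LbNS_impR: "labelled_nseq R X (add_mset (x, A \<^bold>\<supset> B) Y) \<Longrightarrow>
    y \<notin> Field R \<union> labels X \<union> labels (add_mset (x, A \<^bold>\<supset> B) Y) \<Longrightarrow>
    LbNS_mLJ (insert (x, y) R) (add_mset (y, A) X) (add_mset (y, B) Y) \<Longrightarrow>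
    LbNS_mLJ R X (add_mset (x, A \<^bold>\<supset> B) Y)"
| LbNS_lift: "labelled_nseq (insert (x, y) R) (add_mset (x, A) X) Y \<Longrightarrow>
    LbNS_mLJ (insert (x, y) R) (add_mset (x, A) (add_mset (y, A) X)) Y \<Longrightarrow>
    LbNS_mLJ (insert (x, y) R) (add_mset (x, A) X) Y"

end

theory Submission
  imports Defs
begin

text \<open>Every \<open>mLJ\<close> derivation can be replayed in a component of any larger structure; for
  \<open>\<supset>\<^sub>R\<close> the new component receives the whole antecedent by lifting.

  Linear nested sequents rewrite only the last component, so a derivable list yields the \<open>mLJ\<close>
  sequent whose antecedent collects all antecedents of the list and whose succedent is the last one.
  In \<open>NS\<close> and \<open>LbNS\<close> different branches of the tree may close different branches of the derivation,
  so no single component is derivable in \<open>mLJ\<close>. There, an underivable \<open>mLJ\<close> sequent is saturated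
  to a Hintikka pair \<open>(T, S)\<close>; assigning such pairs to the components of a tree, monotonically in
  \<open>T\<close>, refutes it, and every rule with a refuted conclusion has a refuted premise.\<close>

section \<open>Embedding \<open>mLJ\<close>\<close>

primrec ctx_comp :: "'a nctx \<Rightarrow> 'a nctx \<Rightarrow> 'a nctx" where
  "ctx_comp CHole D = D"
| "ctx_comp (CNest \<Gamma> \<Delta> \<Lambda> C) D = CNest \<Gamma> \<Delta> \<Lambda> (ctx_comp C D)"

text \<open>The rules act at a single hole, so a child of a component inside \<open>C\<close> is
  reached by extending \<open>C\<close>.\<close>

lemma fill_ctx_comp: "fill (ctx_comp C D) G = fill C (fill D G)"
  by (induction C) auto

text \<open>Since \<open>lift\<close> copies, passing from its premise to its conclusion erases from
  the child a formula that the parent still has; \<Sigma> is erased one formula at a time while the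
  parent stays fixed.\<close>

lemma NS_lifts:
  assumes "NS_mLJ (fill C (NSeq \<Gamma> \<Delta> (add_mset (NSeq (\<Sigma> + \<Gamma>') \<Delta>' \<Lambda>') \<Lambda>)))" "\<Sigma> \<subseteq># \<Gamma>"
  shows "NS_mLJ (fill C (NSeq \<Gamma> \<Delta> (add_mset (NSeq \<Gamma>' \<Delta>' \<Lambda>') \<Lambda>)))"
  using assms
proof (induction \<Sigma>)
  case (add A \<Sigma>)
  then obtain \<Gamma>0 where \<Gamma>: "\<Gamma> = add_mset A \<Gamma>0"
    using mset_subset_eq_insertD multi_member_split by metis
  have "NS_mLJ (fill C (NSeq \<Gamma> \<Delta> (add_mset (NSeq (\<Sigma> + \<Gamma>') \<Delta>' \<Lambda>') \<Lambda>)))"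
    using add.prems(1) NS_lift[of C A \<Gamma>0 \<Delta> "\<Sigma> + \<Gamma>'" \<Delta>' \<Lambda>' \<Lambda>] \<Gamma> by simp
  then show ?case
    using add.IH mset_subset_eq_insertD[OF add.prems(2)] by (simp add: subset_mset.less_imp_le)
qed simp

text \<open>Context and nestings are arbitrary so that, for the right implication rule, the
  hypothesis applies inside the freshly opened component.\<close>

lemma mLJ_imp_NS: "mLJ \<Gamma> \<Delta> \<Longrightarrow> NS_mLJ (fill C (NSeq \<Gamma> \<Delta> \<Lambda>))"
proof (induction arbitrary: C \<Lambda> rule: mLJ.induct)
  case (mLJ_impR A \<Gamma> B \<Delta>)
  have "NS_mLJ (fill C (NSeq \<Gamma> \<Delta> (add_mset (NSeq (\<Gamma> + {#A#}) {#B#} {#}) \<Lambda>)))"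
    using mLJ_impR.IH[of "ctx_comp C (CNest \<Gamma> \<Delta> \<Lambda> CHole)" "{#}"] by (simp add: fill_ctx_comp)
  then have "NS_mLJ (fill C (NSeq \<Gamma> \<Delta> (add_mset (NSeq {#A#} {#B#} {#}) \<Lambda>)))"
    by (rule NS_lifts) simp
  then show ?case
    by (rule NS_impR)
next
  case mLJ_conjL
  show ?case by (rule NS_conjL[OF mLJ_conjL.IH])
next
  case mLJ_conjR
  show ?case by (rule NS_conjR[OF mLJ_conjR.IH])
next
  case mLJ_disjL
  show ?case by (rule NS_disjL[OF mLJ_disjL.IH])
next
  case mLJ_disjR
  show ?case by (rule NS_disjR[OF mLJ_disjR.IH])
next
  case mLJ_impL
  show ?case by (rule NS_impL[OF mLJ_impL.IH])
qed (rule NS_bot NS_init)+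

section \<open>Embedding into linear nested sequents\<close>

lemma LNS_lifts:
  "LNS_mLJ (G @ [(\<Gamma>, \<Delta>), (\<Sigma> + \<Gamma>', \<Delta>')]) \<Longrightarrow> LNS_mLJ (G @ [(\<Sigma> + \<Gamma>, \<Delta>), (\<Gamma>', \<Delta>')])"
proof (induction \<Sigma> arbitrary: \<Gamma>)
  case (add A \<Sigma>)
  then have "LNS_mLJ (G @ [(add_mset A \<Gamma>, \<Delta>), (\<Sigma> + \<Gamma>', \<Delta>')])"
    using LNS_lift[of G \<Gamma> \<Delta> A "\<Sigma> + \<Gamma>'" \<Delta>'] by simp
  \<comment> \<open>Here \<open>lift\<close> moves the formula, so the earlier component has grown
    by \<open>A\<close>; hence the induction generalises over \<Gamma>.\<close>
  then show ?case
    using add.IH[of "add_mset A \<Gamma>"] by simp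
qed simp

lemma mLJ_imp_LNS: "mLJ \<Gamma> \<Delta> \<Longrightarrow> LNS_mLJ (G @ [(\<Gamma>, \<Delta>)])"
proof (induction arbitrary: G rule: mLJ.induct)
  case (mLJ_impR A \<Gamma> B \<Delta>)
  \<comment> \<open>All of \<Gamma> was moved on to the new component, so the hypothesis is used
    with \<open>({#}, \<Delta>)\<close> in front of it.\<close>
  then show ?case
    using LNS_lifts[of G "{#}" \<Delta> \<Gamma> "{#A#}"] mLJ_impR.IH[of "G @ [({#}, \<Delta>)]"]
      LNS_impR[of G \<Gamma> \<Delta> A B] by simp
next
  case mLJ_conjL
  show ?case by (rule LNS_conjL[OF mLJ_conjL.IH])
next
  case mLJ_conjR
  show ?case by (rule LNS_conjR[OF mLJ_conjR.IH])
next
  case mLJ_disjL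
  show ?case by (rule LNS_disjL[OF mLJ_disjL.IH])
next
  case mLJ_disjR
  show ?case by (rule LNS_disjR[OF mLJ_disjR.IH])
next
  case mLJ_impL
  show ?case by (rule LNS_impL[OF mLJ_impL.IH])
qed (rule LNS_bot LNS_init)+

section \<open>Embedding into labelled nested sequents\<close>

lemma lab_simps [simp]:
  "lab x {#} = {#}" "lab x (add_mset A \<Gamma>) = add_mset (x, A) (lab x \<Gamma>)"
  by (simp_all add: lab_def)

lemma labels_simps [simp]:
  "labels {#} = {}" "labels (add_mset (x, A) X) = insert x (labels X)"
  "labels (X + Y) = labels X \<union> labels Y"
  by (auto simp: labels_def)

lemma finite_labels [simp]: "finite (labels X)"
  by (simp add: labels_def)

lemma labels_lab_subset: "labels (lab x \<Gamma>) \<subseteq> {x}"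
  by (auto simp: lab_def labels_def)

lemma labelled_nseq_mono:
  "labelled_nseq R X Y \<Longrightarrow> labels X' \<union> labels Y' \<subseteq> labels X \<union> labels Y \<Longrightarrow> labelled_nseq R X' Y'"
  unfolding labelled_nseq_def by (metis subset_trans)

text \<open>The new edge hangs a leaf \<open>y\<close> below \<open>x\<close>, so the old root
  remains the root; if \<open>R\<close> is empty, \<open>x\<close> becomes the root.\<close>

lemma treelike_insert:
  assumes "treelike R" "R \<noteq> {} \<Longrightarrow> x \<in> Field R" "y \<notin> Field R" "x \<noteq> y"
  shows "treelike (insert (x, y) R)"
proof (cases "R = {}")
  case True
  then show ?thesis
    using assms(4) by (auto simp: treelike_def single_valued_def Field_def)
next
  case False
  then obtain r where R: "finite R" "single_valued (R\<inverse>)" "r \<notin> Range R"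
      "\<And>z. z \<in> Field R \<Longrightarrow> (r, z) \<in> R\<^sup>*"
    using assms(1) unfolding treelike_def by blast
  have x: "x \<in> Field R"
    using False assms(2) by simp
  have mono: "R\<^sup>* \<subseteq> (insert (x, y) R)\<^sup>*"
    by (rule rtrancl_mono) auto
  have "(r, y) \<in> (insert (x, y) R)\<^sup>*"
    using R(4)[OF x] mono by (meson insertI1 rtrancl.rtrancl_into_rtrancl subsetD)
  \<comment> \<open>\<open>r\<close> is a node of \<open>R\<close>, being \<open>x\<close> or having
    an outgoing edge on the path to \<open>x\<close>; \<open>y\<close> is not.\<close>
  moreover have "r \<noteq> y"
    using R(4)[OF x] assms(3) x by (metis Field_def UnCI DomainI converse_rtranclE)
  moreover have "single_valued ((insert (x, y) R)\<inverse>)"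
    using R(2) assms(3) by (auto simp: single_valued_def Field_def)
  ultimately show ?thesis
    unfolding treelike_def using R mono x by (intro disjI2 conjI exI[of _ r]) auto
qed

text \<open>When there are no edges yet, the occurrence of \<open>x\<close> in the sequent forces
  the common label to be \<open>x\<close>, which becomes a node together with
  \<open>y\<close>.\<close>

lemma labelled_nseq_insert:
  assumes "labelled_nseq R X Y" "x \<in> labels X \<union> labels Y" "y \<notin> Field R" "x \<noteq> y"
    "labels X' \<union> labels Y' \<subseteq> insert y (labels X \<union> labels Y)"
  shows "labelled_nseq (insert (x, y) R) X' Y'"
proof -
  have "treelike (insert (x, y) R)"
    using assms by (intro treelike_insert) (auto simp: labelled_nseq_def)
  moreover have "labels X \<union> labels Y \<subseteq> Field (insert (x, y) R)"
    using assms(1,2) by (auto simp: labelled_nseq_def split: if_splits)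
  ultimately show ?thesis
    using assms(5) unfolding labelled_nseq_def by auto
qed

text \<open>As for nested sequents, the copies at \<open>y\<close> are erased one at a time;
  \<open>y\<close> is a node of \<open>R\<close>, so every intermediate sequent is again a labelled
  nested sequent.\<close>

lemma LbNS_lifts:
  assumes "LbNS_mLJ R (lab y \<Sigma> + X) Y" "(x, y) \<in> R" "labelled_nseq R X Y" "lab x \<Sigma> \<subseteq># X"
  shows "LbNS_mLJ R X Y"
  using assms
proof (induction \<Sigma>)
  case (add A \<Sigma>)
  then obtain X0 where X: "X = add_mset (x, A) X0"
    by (metis insert_subset_eq_iff lab_simps(2) multi_member_split)
  have R: "insert (x, y) R = R"
    using add.prems by auto
  have "labelled_nseq R (lab y \<Sigma> + X) Y"
    using add.prems(2,3) labels_lab_subset[of y \<Sigma>]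
    by (auto simp: labelled_nseq_def Field_def split: if_splits)
  then have "LbNS_mLJ R (lab y \<Sigma> + X) Y"
    using add.prems(1) LbNS_lift[of x y R A "lab y \<Sigma> + X0" Y]
    by (simp add: R X add_mset_commute)
  moreover have "lab x \<Sigma> \<subseteq># X"
    using add.prems(4) by (metis lab_simps(2) mset_subset_eq_insertD subset_mset.less_imp_le)
  ultimately show ?case
    using add.IH add.prems(2,3) by blast
qed simp

text \<open>\<open>X\<close> and \<open>Y\<close> are side formulae at whatever labels; keeping
  them, \<open>R\<close> and \<open>x\<close> arbitrary lets the derivation continue at a fresh
  label.\<close>

lemma mLJ_imp_LbNS:
  "mLJ \<Gamma> \<Delta> \<Longrightarrow> labelled_nseq R (lab x \<Gamma> + X) (lab x \<Delta> + Y) \<Longrightarrow>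
    LbNS_mLJ R (lab x \<Gamma> + X) (lab x \<Delta> + Y)"
proof (induction arbitrary: R x X Y rule: mLJ.induct)
  case (mLJ_conjL A B \<Gamma> \<Delta>)
  have "LbNS_mLJ R (lab x (add_mset A (add_mset B \<Gamma>)) + X) (lab x \<Delta> + Y)"
    by (rule mLJ_conjL.IH, rule labelled_nseq_mono[OF mLJ_conjL.prems], auto)
  then show ?case
    using LbNS_conjL[of R x A B "lab x \<Gamma> + X" "lab x \<Delta> + Y"] mLJ_conjL.prems by simp
next
  case (mLJ_conjR \<Gamma> A \<Delta> B)
  have "LbNS_mLJ R (lab x \<Gamma> + X) (lab x (add_mset A \<Delta>) + Y)"
    by (rule mLJ_conjR.IH(1), rule labelled_nseq_mono[OF mLJ_conjR.prems], auto)
  moreover have "LbNS_mLJ R (lab x \<Gamma> + X) (lab x (add_mset B \<Delta>) + Y)"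
    by (rule mLJ_conjR.IH(2), rule labelled_nseq_mono[OF mLJ_conjR.prems], auto)
  ultimately show ?case
    using LbNS_conjR[of R "lab x \<Gamma> + X" x A B "lab x \<Delta> + Y"] mLJ_conjR.prems by simp
next
  case (mLJ_disjL A \<Gamma> \<Delta> B)
  have "LbNS_mLJ R (lab x (add_mset A \<Gamma>) + X) (lab x \<Delta> + Y)"
    by (rule mLJ_disjL.IH(1), rule labelled_nseq_mono[OF mLJ_disjL.prems], auto)
  moreover have "LbNS_mLJ R (lab x (add_mset B \<Gamma>) + X) (lab x \<Delta> + Y)"
    by (rule mLJ_disjL.IH(2), rule labelled_nseq_mono[OF mLJ_disjL.prems], auto)
  ultimately show ?case
    using LbNS_disjL[of R x A B "lab x \<Gamma> + X" "lab x \<Delta> + Y"] mLJ_disjL.prems by simp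
next
  case (mLJ_disjR \<Gamma> A B \<Delta>)
  have "LbNS_mLJ R (lab x \<Gamma> + X) (lab x (add_mset A (add_mset B \<Delta>)) + Y)"
    by (rule mLJ_disjR.IH, rule labelled_nseq_mono[OF mLJ_disjR.prems], auto)
  then show ?case
    using LbNS_disjR[of R "lab x \<Gamma> + X" x A B "lab x \<Delta> + Y"] mLJ_disjR.prems by simp
next
  case (mLJ_impL A B \<Gamma> \<Delta>)
  have "LbNS_mLJ R (lab x (add_mset (A \<^bold>\<supset> B) \<Gamma>) + X) (lab x (add_mset A \<Delta>) + Y)"
    by (rule mLJ_impL.IH(1), rule labelled_nseq_mono[OF mLJ_impL.prems], auto)
  moreover have "LbNS_mLJ R (lab x (add_mset B \<Gamma>) + X) (lab x \<Delta> + Y)"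
    by (rule mLJ_impL.IH(2), rule labelled_nseq_mono[OF mLJ_impL.prems], auto)
  ultimately show ?case
    using LbNS_impL[of R x A B "lab x \<Gamma> + X" "lab x \<Delta> + Y"] mLJ_impL.prems by simp
next
  case (mLJ_impR A \<Gamma> B \<Delta>)
  let ?X = "lab x \<Gamma> + X" and ?Y = "lab x \<Delta> + Y"
  have seq: "labelled_nseq R ?X (add_mset (x, A \<^bold>\<supset> B) ?Y)"
    using mLJ_impR.prems by simp
  then have "finite R"
    by (auto simp: labelled_nseq_def treelike_def)
  then have "finite (Field R \<union> labels ?X \<union> labels (add_mset (x, A \<^bold>\<supset> B) ?Y))"
    by (simp add: finite_Field)
  then obtain y where y: "y \<notin> Field R \<union> labels ?X \<union> labels (add_mset (x, A \<^bold>\<supset> B) ?Y)"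
    using ex_new_if_finite[OF infinite_UNIV_nat] by metis
  \<comment> \<open>Used for two sequents over the enlarged tree: with and without the copy of
    \<Gamma> at \<open>y\<close>.\<close>
  have seq': "labelled_nseq (insert (x, y) R) X' Y'"
    if "labels X' \<union> labels Y' \<subseteq> insert y (labels ?X \<union> labels (add_mset (x, A \<^bold>\<supset> B) ?Y))" for X' Y'
    using y by (intro labelled_nseq_insert[OF seq _ _ _ that]) auto
  \<comment> \<open>The hypothesis is used at \<open>y\<close>, with everything at the old labels as
    side formulae; the copy of \<Gamma> is lifted away afterwards.\<close>
  have "LbNS_mLJ (insert (x, y) R) (lab y (add_mset A \<Gamma>) + ?X) (lab y {#B#} + ?Y)"
    using labels_lab_subset[of y \<Gamma>] by (intro mLJ_impR.IH seq') auto
  then have "LbNS_mLJ (insert (x, y) R) (lab y \<Gamma> + add_mset (y, A) ?X) (add_mset (y, B) ?Y)"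
    by simp
  then have "LbNS_mLJ (insert (x, y) R) (add_mset (y, A) ?X) (add_mset (y, B) ?Y)"
  proof (rule LbNS_lifts)
    show "labelled_nseq (insert (x, y) R) (add_mset (y, A) ?X) (add_mset (y, B) ?Y)"
      by (intro seq') auto
    have "lab x \<Gamma> \<subseteq># lab x \<Gamma> + add_mset (y, A) X"
      by (rule mset_subset_eq_add_left)
    then show "lab x \<Gamma> \<subseteq># add_mset (y, A) ?X"
      by simp
  qed simp
  then show ?case
    using LbNS_impR[OF seq y] by simp
qed (auto intro: LbNS_bot LbNS_init)

section \<open>Linear nested sequents\<close>

text \<open>Serves the non-atomic \<open>init\<close> of linear nested sequents.\<close>

lemma mLJ_identity: "mLJ (add_mset A \<Gamma>) (add_mset A \<Delta>)"
proof (induction A arbitrary: \<Gamma> \<Delta>)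
  case (Conj A B)
  show ?case
    using Conj.IH(1)[of "add_mset B \<Gamma>" \<Delta>] Conj.IH(2)[of "add_mset A \<Gamma>" \<Delta>]
    by (auto intro!: mLJ_conjL mLJ_conjR simp: add_mset_commute)
next
  case (Disj A B)
  show ?case
    using Disj.IH(1)[of \<Gamma> "add_mset B \<Delta>"] Disj.IH(2)[of \<Gamma> "add_mset A \<Delta>"]
    by (auto intro!: mLJ_disjL mLJ_disjR simp: add_mset_commute)
next
  case (Imp A B)
  \<comment> \<open>The right implication rule discards \<Delta> and has to come below the left one,
    for which the implication is still available in the antecedent.\<close>
  have "mLJ (add_mset (A \<^bold>\<supset> B) (add_mset A \<Gamma>)) {#B#}"
    using Imp.IH(1)[of "add_mset (A \<^bold>\<supset> B) \<Gamma>" "{#B#}"] Imp.IH(2)[of "add_mset A \<Gamma>" "{#}"]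
      mLJ_impL[of A B "add_mset A \<Gamma>" "{#B#}"] by (simp add: add_mset_commute)
  then show ?case
    by (auto intro!: mLJ_impR simp: add_mset_commute)
qed (auto intro: mLJ_bot mLJ_init)

text \<open>Under this reading \<open>lift\<close> changes nothing, as it only moves a formula
  between summands. \<open>LNS_impR\<close> becomes \<open>mLJ_impR\<close>: in its premise \<Delta>
  is no longer last, and \<open>mLJ_impR\<close> discards it as well.\<close>

lemma LNS_imp_mLJ: "LNS_mLJ S \<Longrightarrow> mLJ (\<Sum>\<^sub># (mset (map fst S))) (snd (last S))"
proof (induction rule: LNS_mLJ.induct)
  case (LNS_impL G A B \<Gamma> \<Delta>)
  then show ?case
    using mLJ_impL[of A B "\<Gamma> + \<Sum>\<^sub># (mset (map fst G))" \<Delta>] by (simp add: add.commute)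
qed (auto intro: mLJ_bot mLJ_conjL mLJ_conjR mLJ_disjL mLJ_disjR mLJ_impR mLJ_identity)

section \<open>Hintikka pairs\<close>

text \<open>The pairs are the worlds of a Kripke countermodel, ordered by inclusion of their first
  components. \<open>impL\<close> inspects one world only, because an implication in
  \<open>T\<close> persists to all larger worlds; \<open>impR\<close> alone asks for another
  world.\<close>

locale hintikka =
  fixes W :: "('a form set \<times> 'a form set) set"
  assumes bot: "(T, S) \<in> W \<Longrightarrow> \<^bold>\<bottom> \<notin> T"
    and atom: "(T, S) \<in> W \<Longrightarrow> Atom P \<in> T \<Longrightarrow> Atom P \<notin> S"
    and conjL: "(T, S) \<in> W \<Longrightarrow> A \<^bold>\<and> B \<in> T \<Longrightarrow> A \<in> T \<and> B \<in> T"
    and conjR: "(T, S) \<in> W \<Longrightarrow> A \<^bold>\<and> B \<in> S \<Longrightarrow> A \<in> S \<or> B \<in> S"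
    and disjL: "(T, S) \<in> W \<Longrightarrow> A \<^bold>\<or> B \<in> T \<Longrightarrow> A \<in> T \<or> B \<in> T"
    and disjR: "(T, S) \<in> W \<Longrightarrow> A \<^bold>\<or> B \<in> S \<Longrightarrow> A \<in> S \<and> B \<in> S"
    and impL: "(T, S) \<in> W \<Longrightarrow> A \<^bold>\<supset> B \<in> T \<Longrightarrow> A \<in> S \<or> B \<in> T"
    and impR: "(T, S) \<in> W \<Longrightarrow> A \<^bold>\<supset> B \<in> S \<Longrightarrow> \<exists>T' S'. (T', S') \<in> W \<and> T \<subseteq> T' \<and> A \<in> T' \<and> B \<in> S'"
begin

text \<open>The second components along an edge are unrelated: only antecedents persist.\<close>

inductive refuted :: "'a form set \<Rightarrow> 'a form set \<Rightarrow> 'a nseq \<Rightarrow> bool" where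
  "(T, S) \<in> W \<Longrightarrow> set_mset \<Gamma> \<subseteq> T \<Longrightarrow> set_mset \<Delta> \<subseteq> S \<Longrightarrow>
    \<forall>G\<in>#\<Lambda>. \<exists>T' S'. T \<subseteq> T' \<and> refuted T' S' G \<Longrightarrow> refuted T S (NSeq \<Gamma> \<Delta> \<Lambda>)"

lemma refuted_NSeq:
  "refuted T S (NSeq \<Gamma> \<Delta> \<Lambda>) \<longleftrightarrow> (T, S) \<in> W \<and> set_mset \<Gamma> \<subseteq> T \<and> set_mset \<Delta> \<subseteq> S \<and>
    (\<forall>G\<in>#\<Lambda>. \<exists>T' S'. T \<subseteq> T' \<and> refuted T' S' G)"
  by (subst refuted.simps) auto

text \<open>Only the subtree in the hole is reassigned, and its root keeps its pair, so monotonicity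
  towards the surrounding tree survives. The two alternatives serve the rules with two
  premises.\<close>

lemma refuted_fill:
  assumes "refuted T S (fill C G)" "\<And>T S. refuted T S G \<Longrightarrow> refuted T S G1 \<or> refuted T S G2"
  shows "refuted T S (fill C G1) \<or> refuted T S (fill C G2)"
  using assms(1)
proof (induction C arbitrary: T S)
  case CHole
  then show ?case using assms(2) by simp
next
  case (CNest \<Gamma> \<Delta> \<Lambda> C)
  then obtain T' S' where "T \<subseteq> T'" "refuted T' S' (fill C G)"
    by (auto simp: refuted_NSeq)
  then have "\<exists>T' S'. T \<subseteq> T' \<and> (refuted T' S' (fill C G1) \<or> refuted T' S' (fill C G2))"
    using CNest.IH by blast
  with CNest.prems show ?case
    by (auto simp: refuted_NSeq)
qed

lemma not_refuted_fill:
  assumes "\<And>T S. \<not> refuted T S G"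
  shows "\<not> refuted T S (fill C G)"
  using assms by (induction C arbitrary: T S) (auto simp: refuted_NSeq)

lemma not_refuted_fill1:
  assumes "\<And>T S. \<not> refuted T S (fill C G')" "\<And>T S. refuted T S G \<Longrightarrow> refuted T S G'"
  shows "\<not> refuted T S (fill C G)"
  using assms refuted_fill[of T S C G G' G'] by blast

lemma not_refuted_fill2:
  assumes "\<And>T S. \<not> refuted T S (fill C G1)" "\<And>T S. \<not> refuted T S (fill C G2)"
    and "\<And>T S. refuted T S G \<Longrightarrow> refuted T S G1 \<or> refuted T S G2"
  shows "\<not> refuted T S (fill C G)"
  using assms refuted_fill by blast

text \<open>Each clause of \<open>hintikka\<close> settles one axiom or pushes a refutation from the
  conclusion of one rule to a premise; \<open>lift\<close> rests on monotonicity instead.\<close>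

lemma NS_not_refuted: "NS_mLJ G \<Longrightarrow> \<not> refuted T S G"
proof (induction arbitrary: T S rule: NS_mLJ.induct)
  case NS_bot
  show ?case by (rule not_refuted_fill) (auto simp: refuted_NSeq dest: bot)
next
  case NS_init
  show ?case by (rule not_refuted_fill) (auto simp: refuted_NSeq dest: atom)
next
  case NS_conjL
  show ?case by (rule not_refuted_fill1[OF NS_conjL.IH]) (auto simp: refuted_NSeq dest: conjL)
next
  case NS_conjR
  show ?case by (rule not_refuted_fill2[OF NS_conjR.IH]) (auto simp: refuted_NSeq dest: conjR)
next
  case NS_disjL
  show ?case by (rule not_refuted_fill2[OF NS_disjL.IH]) (auto simp: refuted_NSeq dest: disjL)
next
  case NS_disjR
  show ?case by (rule not_refuted_fill1[OF NS_disjR.IH]) (auto simp: refuted_NSeq dest: disjR)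
next
  case NS_impL
  show ?case by (rule not_refuted_fill2[OF NS_impL.IH]) (auto simp: refuted_NSeq dest: impL)
next
  case (NS_impR C \<Gamma> \<Delta> A B \<Lambda>)
  show ?case
  proof (rule not_refuted_fill1[OF NS_impR.IH])
    fix T S
    assume ref: "refuted T S (NSeq \<Gamma> (add_mset (A \<^bold>\<supset> B) \<Delta>) \<Lambda>)"
    then have "(T, S) \<in> W" "A \<^bold>\<supset> B \<in> S"
      by (simp_all add: refuted_NSeq)
    then obtain T' S' where "(T', S') \<in> W" "T \<subseteq> T'" "A \<in> T'" "B \<in> S'"
      using impR by blast
    then have "T \<subseteq> T' \<and> refuted T' S' (NSeq {#A#} {#B#} {#})"
      by (simp add: refuted_NSeq)
    then show "refuted T S (NSeq \<Gamma> \<Delta> (add_mset (NSeq {#A#} {#B#} {#}) \<Lambda>))"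
      using ref by (auto simp: refuted_NSeq)
  qed
next
  case (NS_lift C A \<Gamma> \<Delta> \<Gamma>' \<Delta>' \<Lambda>' \<Lambda>)
  show ?case
  proof (rule not_refuted_fill1[OF NS_lift.IH])
    fix T S
    assume ref: "refuted T S (NSeq (add_mset A \<Gamma>) \<Delta> (add_mset (NSeq \<Gamma>' \<Delta>' \<Lambda>') \<Lambda>))"
    \<comment> \<open>Unfolding only at \<open>T\<close> keeps the child folded;
      \<open>T \<subseteq> T'\<close> then puts \<open>A\<close> into \<open>T'\<close>.\<close>
    then obtain T' S' where "A \<in> T" "T \<subseteq> T'" "refuted T' S' (NSeq \<Gamma>' \<Delta>' \<Lambda>')"
      unfolding refuted_NSeq[of T] by auto
    then have "T \<subseteq> T' \<and> refuted T' S' (NSeq (add_mset A \<Gamma>') \<Delta>' \<Lambda>')"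
      unfolding refuted_NSeq[of T'] by auto
    then show "refuted T S (NSeq (add_mset A \<Gamma>) \<Delta> (add_mset (NSeq (add_mset A \<Gamma>') \<Delta>' \<Lambda>') \<Lambda>))"
      using ref unfolding refuted_NSeq[of T] by auto
  qed
qed

section \<open>Refuting labelled nested sequents\<close>

definition labelled_refuted ::
    "(label \<Rightarrow> 'a form set \<times> 'a form set) \<Rightarrow> label rel \<Rightarrow> 'a lform multiset \<Rightarrow> 'a lform multiset \<Rightarrow> bool"
  where "labelled_refuted f R X Y \<longleftrightarrow> (\<forall>x. f x \<in> W) \<and>
    (\<forall>(x, y)\<in>R. fst (f x) \<subseteq> fst (f y)) \<and>
    (\<forall>(x, A)\<in>#X. A \<in> fst (f x)) \<and> (\<forall>(x, A)\<in>#Y. A \<in> snd (f x))"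

lemma LbNS_not_refuted: "LbNS_mLJ R X Y \<Longrightarrow> \<not> labelled_refuted f R X Y"
proof (induction arbitrary: f rule: LbNS_mLJ.induct)
  case (LbNS_impR R X x A B Y y)
  show ?case
  proof
    assume ref: "labelled_refuted f R X (add_mset (x, A \<^bold>\<supset> B) Y)"
    have "(fst (f x), snd (f x)) \<in> W" "A \<^bold>\<supset> B \<in> snd (f x)"
      using ref by (auto simp: labelled_refuted_def)
    then obtain T' S' where w: "(T', S') \<in> W" "fst (f x) \<subseteq> T'" "A \<in> T'" "B \<in> S'"
      using impR by blast
    \<comment> \<open>By freshness, redefining \<open>f\<close> at \<open>y\<close> affects neither
      the old edges nor the old formulae.\<close>
    have ne: "x \<noteq> y" "\<And>z C. (z, C) \<in># X \<Longrightarrow> z \<noteq> y" "\<And>z C. (z, C) \<in># Y \<Longrightarrow> z \<noteq> y"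
        "\<And>u v. (u, v) \<in> R \<Longrightarrow> u \<noteq> y \<and> v \<noteq> y"
      using LbNS_impR.hyps(2) by (force simp: labels_def Field_def)+
    have "labelled_refuted (f(y := (T', S'))) (insert (x, y) R) (add_mset (y, A) X) (add_mset (y, B) Y)"
      using ref w ne(1) unfolding labelled_refuted_def by (fastforce dest: ne(2-4))
    then show False
      using LbNS_impR.IH by blast
  qed
next
  case (LbNS_bot R x X Y)
  then show ?case
    using bot[of "fst (f x)" "snd (f x)"] by (auto simp: labelled_refuted_def)
next
  case (LbNS_init R x P X Y)
  then show ?case
    using atom[of "fst (f x)" "snd (f x)" P] by (auto simp: labelled_refuted_def)
next
  case (LbNS_conjL R x A B X Y)
  then show ?case
    using conjL[of "fst (f x)" "snd (f x)" A B] LbNS_conjL.IH[of f]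
    by (auto simp: labelled_refuted_def)
next
  case (LbNS_conjR R X x A B Y)
  then show ?case
    using conjR[of "fst (f x)" "snd (f x)" A B] LbNS_conjR.IH[of f]
    by (auto simp: labelled_refuted_def)
next
  case (LbNS_disjL R x A B X Y)
  then show ?case
    using disjL[of "fst (f x)" "snd (f x)" A B] LbNS_disjL.IH[of f]
    by (auto simp: labelled_refuted_def)
next
  case (LbNS_disjR R X x A B Y)
  then show ?case
    using disjR[of "fst (f x)" "snd (f x)" A B] LbNS_disjR.IH[of f]
    by (auto simp: labelled_refuted_def)
next
  case (LbNS_impL R x A B X Y)
  then show ?case
    using impL[of "fst (f x)" "snd (f x)" A B] LbNS_impL.IH[of f]
    by (auto simp: labelled_refuted_def)
next
  case (LbNS_lift x y R A X Y)
  then show ?case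
    using LbNS_lift.IH[of f] by (auto simp: labelled_refuted_def)
qed

end

section \<open>Saturation of underivable sequents\<close>

text \<open>The rules of \<open>mLJ\<close> consume their principal formula; these closures recover, from a saturated
  sequent, all the formulae decomposed on the way to it, so no contraction is needed.\<close>

inductive_set closL :: "'a form set \<Rightarrow> 'a form set" for T where
  base: "A \<in> T \<Longrightarrow> A \<in> closL T"
| conj: "A \<in> closL T \<Longrightarrow> B \<in> closL T \<Longrightarrow> A \<^bold>\<and> B \<in> closL T"
| disj1: "A \<in> closL T \<Longrightarrow> A \<^bold>\<or> B \<in> closL T"
| disj2: "B \<in> closL T \<Longrightarrow> A \<^bold>\<or> B \<in> closL T"
| imp: "B \<in> closL T \<Longrightarrow> A \<^bold>\<supset> B \<in> closL T"

inductive_set closR :: "'a form set \<Rightarrow> 'a form set" for S where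
  base: "A \<in> S \<Longrightarrow> A \<in> closR S"
| conj1: "A \<in> closR S \<Longrightarrow> A \<^bold>\<and> B \<in> closR S"
| conj2: "B \<in> closR S \<Longrightarrow> A \<^bold>\<and> B \<in> closR S"
| disj: "A \<in> closR S \<Longrightarrow> B \<in> closR S \<Longrightarrow> A \<^bold>\<or> B \<in> closR S"

text \<open>Monotonicity and idempotence of the closure in one statement.\<close>

lemma closL_subset: "T \<subseteq> closL T' \<Longrightarrow> closL T \<subseteq> closL T'"
proof
  show "A \<in> closL T'" if "T \<subseteq> closL T'" "A \<in> closL T" for A
    using that(2,1) by induction (auto intro: closL.intros)
qed

lemma closR_subset: "S \<subseteq> closR S' \<Longrightarrow> closR S \<subseteq> closR S'"
proof
  show "A \<in> closR S'" if "S \<subseteq> closR S'" "A \<in> closR S" for A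
    using that(2,1) by induction (auto intro: closR.intros)
qed

inductive_cases closL_cases:
  "Atom P \<in> closL T" "\<^bold>\<bottom> \<in> closL T" "A \<^bold>\<and> B \<in> closL T" "A \<^bold>\<or> B \<in> closL T" "A \<^bold>\<supset> B \<in> closL T"

inductive_cases closR_cases:
  "Atom P \<in> closR S" "A \<^bold>\<and> B \<in> closR S" "A \<^bold>\<or> B \<in> closR S" "A \<^bold>\<supset> B \<in> closR S"

text \<open>The antecedent of an implication is sought in the closure because it may itself be
  decomposed later. \<open>Bot\<close> is never finished: on the left it makes the sequent
  derivable.\<close>

definition doneL :: "'a form set \<Rightarrow> 'a form \<Rightarrow> bool" where
  "doneL S A \<longleftrightarrow> (case A of Atom P \<Rightarrow> True | B \<^bold>\<supset> C \<Rightarrow> B \<in> closR S | _ \<Rightarrow> False)"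

text \<open>Implications count as finished here: their rule discards the rest of the succedent, so
  they are treated by passing to another pair.\<close>

definition doneR :: "'a form \<Rightarrow> bool" where
  "doneR A \<longleftrightarrow> (case A of Atom P \<Rightarrow> True | \<^bold>\<bottom> \<Rightarrow> True | B \<^bold>\<supset> C \<Rightarrow> True | _ \<Rightarrow> False)"

definition saturated :: "'a form multiset \<Rightarrow> 'a form multiset \<Rightarrow> bool" where
  "saturated \<Gamma> \<Delta> \<longleftrightarrow> \<not> mLJ \<Gamma> \<Delta> \<and> (\<forall>A\<in>#\<Gamma>. doneL (set_mset \<Delta>) A) \<and> (\<forall>A\<in>#\<Delta>. doneR A)"

text \<open>The factor 2 makes a formula outweigh its two immediate subformulae together; the
  summand 1 makes every removal a strict decrease.\<close>

definition weight :: "'a form multiset \<Rightarrow> nat" where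
  "weight \<Gamma> = (\<Sum>A\<in>#\<Gamma>. 2 * size A + 1)"

lemma weight_simps [simp]:
  "weight {#} = 0" "weight (add_mset A \<Gamma>) = 2 * size A + 1 + weight \<Gamma>"
  by (simp_all add: weight_def)

lemma doneL_mono: "doneL S A \<Longrightarrow> S \<subseteq> closR S' \<Longrightarrow> doneL S' A"
  using closR_subset by (auto simp: doneL_def split: form.splits)

definition saturable :: "'a form multiset \<Rightarrow> 'a form multiset \<Rightarrow> bool" where
  "saturable \<Gamma> \<Delta> \<longleftrightarrow> (\<exists>\<Gamma>' \<Delta>'. saturated \<Gamma>' \<Delta>' \<and>
     set_mset \<Gamma> \<subseteq> closL (set_mset \<Gamma>') \<and> set_mset \<Delta> \<subseteq> closR (set_mset \<Delta>'))"

lemma saturable_trans: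
  assumes "saturable \<Gamma>' \<Delta>'"
    "set_mset \<Gamma> \<subseteq> closL (set_mset \<Gamma>')" "set_mset \<Delta> \<subseteq> closR (set_mset \<Delta>')"
  shows "saturable \<Gamma> \<Delta>"
  using assms closL_subset closR_subset unfolding saturable_def by (meson subset_trans)

text \<open>\<open>\<Theta>\<close> and \<open>\<Sigma>\<close> hold the formulae already processed. Marking \<open>A \<supset> B\<close> as processed once \<open>A\<close> has been
  added on the right keeps the repetition of the principal formula in \<open>\<supset>\<^sub>L\<close> from looping.\<close>

lemma saturation:
  assumes "\<not> mLJ (\<Gamma> + \<Theta>) (\<Delta> + \<Sigma>)" "\<forall>A\<in>#\<Theta>. doneL (set_mset (\<Delta> + \<Sigma>)) A" "\<forall>A\<in>#\<Sigma>. doneR A"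
  shows "saturable (\<Gamma> + \<Theta>) (\<Delta> + \<Sigma>)"
  using assms
proof (induction "weight \<Gamma> + weight \<Delta>" arbitrary: \<Gamma> \<Theta> \<Delta> \<Sigma> rule: less_induct)
  case less
  \<comment> \<open>All cases below share this shape: a lighter underivable sequent whose closures
    still cover the current one. Processed formulae from \<Theta> stay finished by
    \<open>doneL_mono\<close>.\<close>
  have step: "saturable (\<Gamma> + \<Theta>) (\<Delta> + \<Sigma>)"
    if "\<not> mLJ (\<Gamma>' + \<Theta>') (\<Delta>' + \<Sigma>')" "weight \<Gamma>' + weight \<Delta>' < weight \<Gamma> + weight \<Delta>"
      "set_mset (\<Gamma> + \<Theta>) \<subseteq> closL (set_mset (\<Gamma>' + \<Theta>'))"
      "set_mset (\<Delta> + \<Sigma>) \<subseteq> closR (set_mset (\<Delta>' + \<Sigma>'))"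
      "\<forall>A\<in>#\<Theta>'. A \<in># \<Theta> \<or> doneL (set_mset (\<Delta>' + \<Sigma>')) A" "\<forall>A\<in>#\<Sigma>'. doneR A" for \<Gamma>' \<Theta>' \<Delta>' \<Sigma>'
  proof -
    have "\<forall>A\<in>#\<Theta>'. doneL (set_mset (\<Delta>' + \<Sigma>')) A"
      using that(4,5) less.prems(2) doneL_mono by blast
    then show ?thesis
      using less.hyps that saturable_trans by blast
  qed
  show ?case
  proof (cases "\<exists>A. A \<in># \<Gamma>")
    case True
    then obtain C \<Gamma>0 where \<Gamma>: "\<Gamma> = add_mset C \<Gamma>0"
      by (meson multi_member_split)
    show ?thesis
    proof (cases C)
      case (Atom P)
      then show ?thesis
        using less.prems \<Gamma> by (intro step[of \<Gamma>0 "add_mset C \<Theta>" \<Delta> \<Sigma>])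
          (auto intro: closL.base closR.base simp: doneL_def)
    next
      case Bot
      then show ?thesis
        using less.prems(1) \<Gamma> mLJ_bot by auto
    next
      case (Conj A B)
      then have "\<not> mLJ (add_mset A (add_mset B \<Gamma>0) + \<Theta>) (\<Delta> + \<Sigma>)"
        using less.prems(1) \<Gamma> mLJ_conjL by auto
      then show ?thesis
        using less.prems \<Gamma> Conj by (intro step[of "add_mset A (add_mset B \<Gamma>0)" \<Theta> \<Delta> \<Sigma>])
          (auto intro: closL.intros closR.base)
    next
      case (Disj A B)
      then consider "\<not> mLJ (add_mset A \<Gamma>0 + \<Theta>) (\<Delta> + \<Sigma>)" | "\<not> mLJ (add_mset B \<Gamma>0 + \<Theta>) (\<Delta> + \<Sigma>)"
        using less.prems(1) \<Gamma> mLJ_disjL by auto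
      then show ?thesis
      proof cases
        case 1
        then show ?thesis
          using less.prems \<Gamma> Disj by (intro step[of "add_mset A \<Gamma>0" \<Theta> \<Delta> \<Sigma>])
            (auto intro: closL.base closL.disj1 closR.base)
      next
        case 2
        then show ?thesis
          using less.prems \<Gamma> Disj by (intro step[of "add_mset B \<Gamma>0" \<Theta> \<Delta> \<Sigma>])
            (auto intro: closL.base closL.disj2 closR.base)
      qed
    next
      case (Imp A B)
      then consider "\<not> mLJ (\<Gamma>0 + add_mset (A \<^bold>\<supset> B) \<Theta>) (add_mset A \<Delta> + \<Sigma>)"
        | "\<not> mLJ (add_mset B \<Gamma>0 + \<Theta>) (\<Delta> + \<Sigma>)"
        using less.prems(1) \<Gamma> mLJ_impL by auto
      then show ?thesis
      proof cases
        case 1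
        then show ?thesis
          using less.prems \<Gamma> Imp by (intro step[of \<Gamma>0 "add_mset (A \<^bold>\<supset> B) \<Theta>" "add_mset A \<Delta>" \<Sigma>])
            (auto intro: closL.base closR.base simp: doneL_def)
      next
        case 2
        then show ?thesis
          using less.prems \<Gamma> Imp by (intro step[of "add_mset B \<Gamma>0" \<Theta> \<Delta> \<Sigma>])
            (auto intro: closL.base closL.imp closR.base)
      qed
    qed
  next
    case noL: False
    show ?thesis
    proof (cases "\<exists>A. A \<in># \<Delta>")
      case True
      then obtain C \<Delta>0 where \<Delta>: "\<Delta> = add_mset C \<Delta>0"
        by (meson multi_member_split)
      have move: ?thesis if "doneR C"
        using less.prems \<Delta> that by (intro step[of \<Gamma> \<Theta> \<Delta>0 "add_mset C \<Sigma>"])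
          (auto intro: closL.base closR.base)
      show ?thesis
      proof (cases C)
        case (Conj A B)
        then consider "\<not> mLJ (\<Gamma> + \<Theta>) (add_mset A \<Delta>0 + \<Sigma>)" | "\<not> mLJ (\<Gamma> + \<Theta>) (add_mset B \<Delta>0 + \<Sigma>)"
          using less.prems(1) \<Delta> mLJ_conjR by auto
        then show ?thesis
        proof cases
          case 1
          then show ?thesis
            using less.prems \<Delta> Conj by (intro step[of \<Gamma> \<Theta> "add_mset A \<Delta>0" \<Sigma>])
              (auto intro: closL.base closR.base closR.conj1)
        next
          case 2
          then show ?thesis
            using less.prems \<Delta> Conj by (intro step[of \<Gamma> \<Theta> "add_mset B \<Delta>0" \<Sigma>])
              (auto intro: closL.base closR.base closR.conj2)
        qed
      next
        case (Disj A B)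
        then have "\<not> mLJ (\<Gamma> + \<Theta>) (add_mset A (add_mset B \<Delta>0) + \<Sigma>)"
          using less.prems(1) \<Delta> mLJ_disjR by auto
        then show ?thesis
          using less.prems \<Delta> Disj by (intro step[of \<Gamma> \<Theta> "add_mset A (add_mset B \<Delta>0)" \<Sigma>])
            (auto intro: closL.base closR.intros)
      qed (auto intro: move simp: doneR_def)
    next
      case False
      then have "\<Gamma> = {#}" "\<Delta> = {#}"
        using noL by auto
      \<comment> \<open>With nothing left to process, the sequent is its own saturation.\<close>
      then have "saturated (\<Gamma> + \<Theta>) (\<Delta> + \<Sigma>)"
        using less.prems by (auto simp: saturated_def)
      then show ?thesis
        unfolding saturable_def by (meson closL.base closR.base subsetI)
    qed
  qed
qed

section \<open>The Hintikka system of saturated pairs\<close>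

definition saturated_pairs :: "('a form set \<times> 'a form set) set" where
  "saturated_pairs = {(closL (set_mset \<Gamma>), closR (set_mset \<Delta>)) | \<Gamma> \<Delta>. saturated \<Gamma> \<Delta>}"

text \<open>The counterpart of the Lindenbaum lemma. Bounding by closures allows direct comparison
  with other pairs, which are closures themselves.\<close>

lemma underivable_saturated_pair:
  assumes "\<not> mLJ \<Gamma> \<Delta>"
  obtains T S where "(T, S) \<in> saturated_pairs" "closL (set_mset \<Gamma>) \<subseteq> T" "closR (set_mset \<Delta>) \<subseteq> S"
proof -
  have "saturable \<Gamma> \<Delta>"
    using saturation[of \<Gamma> "{#}" \<Delta> "{#}"] assms by simp
  then obtain \<Gamma>' \<Delta>' where "saturated \<Gamma>' \<Delta>'"
      "set_mset \<Gamma> \<subseteq> closL (set_mset \<Gamma>')" "set_mset \<Delta> \<subseteq> closR (set_mset \<Delta>')"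
    unfolding saturable_def by blast
  then show ?thesis
    by (intro that[OF _ closL_subset closR_subset]) (auto simp: saturated_pairs_def)
qed

text \<open>A compound formula of a closure was either built by a closure clause, which supplies the
  components asked for, or belongs to the saturated sequent. There \<open>doneL\<close> and
  \<open>doneR\<close> exclude conjunctions and disjunctions, and \<open>doneL\<close> gives
  \<open>impL\<close>.\<close>

interpretation hintikka saturated_pairs
proof
  fix T S :: "'a form set" and A B P
  assume "(T, S) \<in> saturated_pairs"
  then obtain \<Gamma> \<Delta> where T: "T = closL (set_mset \<Gamma>)" and S: "S = closR (set_mset \<Delta>)"
    and "saturated \<Gamma> \<Delta>"
    by (auto simp: saturated_pairs_def)
  then have und: "\<not> mLJ \<Gamma> \<Delta>" and L: "\<And>A. A \<in># \<Gamma> \<Longrightarrow> doneL (set_mset \<Delta>) A"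
    and R: "\<And>A. A \<in># \<Delta> \<Longrightarrow> doneR A"
    by (auto simp: saturated_def)
  show "\<^bold>\<bottom> \<notin> T"
    unfolding T by (auto elim!: closL_cases dest: L simp: doneL_def)
  show "Atom P \<notin> S" if "Atom P \<in> T"
  proof
    assume "Atom P \<in> S"
    \<comment> \<open>The closures add no atoms, so both occurrences lie in the saturated sequent
      itself, which \<open>mLJ_init\<close> would derive.\<close>
    with that have "Atom P \<in># \<Gamma>" "Atom P \<in># \<Delta>"
      unfolding T S by (auto elim: closL_cases closR_cases)
    then show False
      using und mLJ_init by (metis multi_member_split)
  qed
  show "A \<in> T \<and> B \<in> T" if "A \<^bold>\<and> B \<in> T"
    using that unfolding T by (auto elim!: closL_cases dest: L simp: doneL_def)
  show "A \<in> S \<or> B \<in> S" if "A \<^bold>\<and> B \<in> S"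
    using that unfolding S by (auto elim!: closR_cases dest: R simp: doneR_def)
  show "A \<in> T \<or> B \<in> T" if "A \<^bold>\<or> B \<in> T"
    using that unfolding T by (auto elim!: closL_cases dest: L simp: doneL_def)
  show "A \<in> S \<and> B \<in> S" if "A \<^bold>\<or> B \<in> S"
    using that unfolding S by (auto elim!: closR_cases dest: R simp: doneR_def)
  show "A \<in> S \<or> B \<in> T" if "A \<^bold>\<supset> B \<in> T"
    using that unfolding S T by (auto elim!: closL_cases dest: L simp: doneL_def)
  show "\<exists>T' S'. (T', S') \<in> saturated_pairs \<and> T \<subseteq> T' \<and> A \<in> T' \<and> B \<in> S'" if "A \<^bold>\<supset> B \<in> S"
  proof -
    have "A \<^bold>\<supset> B \<in># \<Delta>"
      using that unfolding S by (auto elim: closR_cases)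
    \<comment> \<open>Underivability passes up through \<open>mLJ_impR\<close>; saturating the
      premise, which retains \<Gamma>, yields the larger pair.\<close>
    then have "\<not> mLJ (add_mset A \<Gamma>) {#B#}"
      using und mLJ_impR by (metis multi_member_split)
    then obtain T' S' where w: "(T', S') \<in> saturated_pairs"
        "closL (set_mset (add_mset A \<Gamma>)) \<subseteq> T'" "closR (set_mset {#B#}) \<subseteq> S'"
      by (rule underivable_saturated_pair)
    moreover have "closL (set_mset \<Gamma>) \<subseteq> closL (set_mset (add_mset A \<Gamma>))"
      by (intro closL_subset) (auto intro: closL.base)
    moreover have "A \<in> closL (set_mset (add_mset A \<Gamma>))" "B \<in> closR (set_mset {#B#})"
      by (auto intro: closL.base closR.base)
    ultimately show ?thesis
      unfolding T by blast
  qed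
qed

section \<open>Return to \<open>mLJ\<close> and the equivalence\<close>

lemma NS_imp_mLJ:
  assumes "NS_mLJ (NSeq \<Gamma> \<Delta> {#})"
  shows "mLJ \<Gamma> \<Delta>"
proof (rule ccontr)
  assume "\<not> mLJ \<Gamma> \<Delta>"
  then obtain T S where "(T, S) \<in> saturated_pairs" "closL (set_mset \<Gamma>) \<subseteq> T" "closR (set_mset \<Delta>) \<subseteq> S"
    by (rule underivable_saturated_pair)
  then have "refuted T S (NSeq \<Gamma> \<Delta> {#})"
    by (auto simp: refuted_NSeq intro: closL.base closR.base)
  then show False
    using NS_not_refuted[OF assms] by blast
qed

lemma LbNS_imp_mLJ:
  assumes "LbNS_mLJ {} (lab x \<Gamma>) (lab x \<Delta>)"
  shows "mLJ \<Gamma> \<Delta>"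
proof (rule ccontr)
  assume "\<not> mLJ \<Gamma> \<Delta>"
  then obtain T S where "(T, S) \<in> saturated_pairs" "closL (set_mset \<Gamma>) \<subseteq> T" "closR (set_mset \<Delta>) \<subseteq> S"
    by (rule underivable_saturated_pair)
  \<comment> \<open>With a single label and no edges, a constant assignment suffices.\<close>
  then have "labelled_refuted (\<lambda>_. (T, S)) {} (lab x \<Gamma>) (lab x \<Delta>)"
    by (auto simp: labelled_refuted_def lab_def intro: closL.base closR.base)
  then show False
    using LbNS_not_refuted[OF assms] by blast
qed

theorem theorem4:
  fixes \<Gamma> \<Delta> :: "'a form multiset" and x :: label
  shows "(mLJ \<Gamma> \<Delta> \<longleftrightarrow> NS_mLJ (NSeq \<Gamma> \<Delta> {#})) \<and>
    (NS_mLJ (NSeq \<Gamma> \<Delta> {#}) \<longleftrightarrow> LNS_mLJ [(\<Gamma>, \<Delta>)]) \<and>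
    (LNS_mLJ [(\<Gamma>, \<Delta>)] \<longleftrightarrow> LbNS_mLJ {} (lab x \<Gamma>) (lab x \<Delta>))"
proof -
  have "labelled_nseq {} (lab x \<Gamma>) (lab x \<Delta>)"
    using labels_lab_subset by (fastforce simp: labelled_nseq_def treelike_def)
  then have "mLJ \<Gamma> \<Delta> \<longleftrightarrow> LbNS_mLJ {} (lab x \<Gamma>) (lab x \<Delta>)"
    using mLJ_imp_LbNS[of \<Gamma> \<Delta> "{}" x "{#}" "{#}"] LbNS_imp_mLJ by auto
  moreover have "mLJ \<Gamma> \<Delta> \<longleftrightarrow> NS_mLJ (NSeq \<Gamma> \<Delta> {#})"
    using mLJ_imp_NS[of \<Gamma> \<Delta> CHole "{#}"] NS_imp_mLJ by auto
  moreover have "mLJ \<Gamma> \<Delta> \<longleftrightarrow> LNS_mLJ [(\<Gamma>, \<Delta>)]"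
    using mLJ_imp_LNS[of \<Gamma> \<Delta> "[]"] LNS_imp_mLJ[of "[(\<Gamma>, \<Delta>)]"] by auto
  ultimately show ?thesis
    by blast
qed

end
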